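(* Let $\mathbb F$ be a field, let $d\ge 1$ be an integer, and let $A=A(d,\mathbb F)$ be the algebra defined in the context. Each of the following is a basis for the $\mathbb F$-vector space $A$: (i) the set of NR words in $A$ that end with a nonstarred element; (ii) the set of NR words in $A$ that end with a starred element; (iii) the set of NR words in $A$ that begin with a nonstarred element; (iv) the set of NR words in $A$ that begin with a starred element.
   Context: Algebras are associative and have a $1$. For a field $\mathbb F$ and an integer $d\ge 1$, $A=A(d,\mathbb F)$ is the $\mathbb F$-algebra defined by generators $\{e_i\}_{i=0}^d$, $\{e^*_i\}_{i=0}^d$ and relations $e_ie_j=\delta_{i,j}e_i$, $e^*_ie^*_j=\delta_{i,j}e^*_i$ $(0\le i,j\le d)$, $1=\sum_{i=0}^d e_i$, $1=\sum_{i=0}^d e^*_i$. The $e_i,e_i^*$ are the idempotent generators; the $e^*_i$ are called starred and the $e_i$ nonstarred; $i$ is the index of $e_i$ and of $e^*_i$. For $n\ge1$, a word of length $n$ in $A$ is a product $g_1g_2\cdots g_n$ of idempotent generators such that for $2\le j\le n$ exactly one of $g_{j-1},g_j$ is starred. It begins with $g_1$ and ends with $g_n$. The word is nonrepeating (NR) if $g_{j-1},g_j$ have different indices for $2\le j\le n$. *)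

theory Defs
  imports
    "HOL-Library.Poly_Mapping"
    "HOL-Algebra.QuotRing"
    "Jordan_Normal_Form.VS_Connect"
begin

text \<open>\<open>NS i\<close> and \<open>St i\<close> are the symbols for $e_i$ and $e^*_i$.\<close>

datatype idem = NS (index: nat) | St (index: nat)

primrec starred :: "idem \<Rightarrow> bool"
  where
    "starred (NS i) = False"
  | "starred (St i) = True"

text \<open>The free monoid on the symbols, written additively because the library's
  convolution product on \<open>\<Rightarrow>\<^sub>0\<close> asks for an (arbitrary, not necessarily commutative)
  additive monoid of exponents.\<close>

datatype monomial = Mon (letters: "idem list")

instantiation monomial :: monoid_add
begin

definition zero_monomial :: monomial
  where "zero_monomial = Mon []"

definition plus_monomial :: "monomial \<Rightarrow> monomial \<Rightarrow> monomial"
  where "plus_monomial u v = Mon (letters u @ letters v)"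

instance
  by standard (simp_all add: zero_monomial_def plus_monomial_def)

end

text \<open>The free unital associative algebra over the field \<open>'f\<close> on the symbols of index at
  most \<open>d\<close>: finitely supported functions on monomials, with convolution as product.\<close>

definition free_algebra :: "nat \<Rightarrow> (monomial \<Rightarrow>\<^sub>0 'f::field) ring"
  where "free_algebra d =
    \<lparr>carrier = {p. \<forall>w \<in> Poly_Mapping.keys p. \<forall>g \<in> set (letters w). index g \<le> d},
     mult = (*), one = 1, zero = 0, add = (+)\<rparr>"

definition var :: "idem \<Rightarrow> (monomial \<Rightarrow>\<^sub>0 'f::field)"
  where "var g = Poly_Mapping.single (Mon [g]) 1"

definition const :: "'f \<Rightarrow> (monomial \<Rightarrow>\<^sub>0 'f::field)"
  where "const c = Poly_Mapping.single 0 c"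

definition relators :: "nat \<Rightarrow> (monomial \<Rightarrow>\<^sub>0 'f::field) set"
  where "relators d =
    {var (NS i) * var (NS j) - (if i = j then var (NS i) else 0) | i j. i \<le> d \<and> j \<le> d} \<union>
    {var (St i) * var (St j) - (if i = j then var (St i) else 0) | i j. i \<le> d \<and> j \<le> d} \<union>
    {1 - (\<Sum>i\<le>d. var (NS i)), 1 - (\<Sum>i\<le>d. var (St i))}"

text \<open>\<open>Idl\<close> is the generated two-sided ideal.\<close>

definition relation_ideal :: "nat \<Rightarrow> (monomial \<Rightarrow>\<^sub>0 'f::field) set"
  where "relation_ideal d = Idl\<^bsub>free_algebra d\<^esub> (relators d)"

definition proj :: "nat \<Rightarrow> (monomial \<Rightarrow>\<^sub>0 'f::field) \<Rightarrow> (monomial \<Rightarrow>\<^sub>0 'f) set"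
  where "proj d p = relation_ideal d +>\<^bsub>free_algebra d\<^esub> p"

text \<open>The algebra $A(d,\mathbb F)$. A scalar \<open>c\<close> acts as multiplication by the image of \<open>c\<close>.\<close>

definition A_alg :: "nat \<Rightarrow> ('f::field, (monomial \<Rightarrow>\<^sub>0 'f) set) module"
  where "A_alg d = (let Q = free_algebra d Quot relation_ideal d in
    \<lparr>carrier = carrier Q, mult = mult Q, one = one Q, zero = zero Q, add = add Q,
     smult = (\<lambda>c x. proj d (const c) \<otimes>\<^bsub>Q\<^esub> x)\<rparr>)"

definition idem_gen :: "nat \<Rightarrow> idem \<Rightarrow> (monomial \<Rightarrow>\<^sub>0 'f::field) set"
  where "idem_gen d g = proj d (var g)"

definition word_product :: "nat \<Rightarrow> idem list \<Rightarrow> (monomial \<Rightarrow>\<^sub>0 'f::field) set"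
  where "word_product d gs = foldr (\<lambda>g x. idem_gen d g \<otimes>\<^bsub>A_alg d\<^esub> x) gs \<one>\<^bsub>A_alg d\<^esub>"

definition is_word :: "nat \<Rightarrow> idem list \<Rightarrow> bool"
  where "is_word d gs \<longleftrightarrow> gs \<noteq> [] \<and> (\<forall>g \<in> set gs. index g \<le> d) \<and>
    successively (\<lambda>g h. starred g \<noteq> starred h) gs"

definition nonrepeating :: "idem list \<Rightarrow> bool"
  where "nonrepeating gs \<longleftrightarrow> successively (\<lambda>g h. index g \<noteq> index h) gs"

text \<open>The set of elements of $A$ that are NR words of a given shape.\<close>

definition NR_words :: "nat \<Rightarrow> (idem list \<Rightarrow> bool) \<Rightarrow> (monomial \<Rightarrow>\<^sub>0 'f::field) set set"
  where "NR_words d P = {word_product d gs | gs. is_word d gs \<and> nonrepeating gs \<and> P gs}"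


subsection \<open>\<open>A_alg d\<close> is an associative unital algebra satisfying the defining relations\<close>

lemma free_algebra_sel [simp]:
  "mult (free_algebra d) = (*)" "one (free_algebra d) = 1"
  "zero (free_algebra d) = 0" "add (free_algebra d) = (+)"
  by (simp_all add: free_algebra_def)

lemma free_carrier_iff:
  "p \<in> carrier (free_algebra d) \<longleftrightarrow>
    (\<forall>w \<in> Poly_Mapping.keys p. \<forall>g \<in> set (letters w). index g \<le> d)"
  by (simp add: free_algebra_def)

lemma free_carrier_add:
  "p \<in> carrier (free_algebra d) \<Longrightarrow> q \<in> carrier (free_algebra d) \<Longrightarrow>
    p + q \<in> carrier (free_algebra d)"
  unfolding free_carrier_iff using Poly_Mapping.keys_add[of p q] by blast

lemma free_carrier_mult:
  assumes "p \<in> carrier (free_algebra d)" "q \<in> carrier (free_algebra d)"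
  shows "p * q \<in> carrier (free_algebra d)"
  unfolding free_carrier_iff
proof (intro ballI)
  fix w g
  assume w: "w \<in> Poly_Mapping.keys (p * q)" and g: "g \<in> set (letters w)"
  from w keys_mult[of p q] obtain u v where "u \<in> Poly_Mapping.keys p"
    "v \<in> Poly_Mapping.keys q" "w = u + v" by blast
  with g assms show "index g \<le> d"
    by (auto simp: free_carrier_iff plus_monomial_def)
qed

lemma free_carrier_uminus:
  "p \<in> carrier (free_algebra d) \<Longrightarrow> - p \<in> carrier (free_algebra d)"
  by (simp add: free_carrier_iff)

lemma free_carrier_const: "const c \<in> carrier (free_algebra d)"
  by (simp add: free_carrier_iff const_def zero_monomial_def)

lemma free_carrier_zero: "0 \<in> carrier (free_algebra d)"
  by (simp add: free_carrier_iff)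

lemma free_carrier_one: "1 \<in> carrier (free_algebra d)"
  by (simp add: free_carrier_iff zero_monomial_def)

lemma free_carrier_var: "index g \<le> d \<Longrightarrow> var g \<in> carrier (free_algebra d)"
  by (simp add: free_carrier_iff var_def)

lemma ring_free_algebra: "ring (free_algebra d :: (monomial \<Rightarrow>\<^sub>0 'f::field) ring)"
proof (rule ringI)
  show "abelian_group (free_algebra d :: (monomial \<Rightarrow>\<^sub>0 'f) ring)"
  proof (rule abelian_groupI)
    fix x :: "monomial \<Rightarrow>\<^sub>0 'f"
    assume "x \<in> carrier (free_algebra d)"
    then show "\<exists>y\<in>carrier (free_algebra d). y \<oplus>\<^bsub>free_algebra d\<^esub> x = \<zero>\<^bsub>free_algebra d\<^esub>"
      by (intro bexI[of _ "- x"]) (auto intro: free_carrier_uminus)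
  qed (auto simp: algebra_simps free_carrier_zero intro: free_carrier_add)
  show "Group.monoid (free_algebra d :: (monomial \<Rightarrow>\<^sub>0 'f) ring)"
    by (rule Group.monoidI) (auto simp: mult.assoc free_carrier_one intro: free_carrier_mult)
qed (auto simp: algebra_simps)

lemma relators_carrier: "relators d \<subseteq> carrier (free_algebra d)"
proof -
  have diff: "p - q \<in> carrier (free_algebra d)"
    if "p \<in> carrier (free_algebra d)" "q \<in> carrier (free_algebra d)"
    for p q :: "monomial \<Rightarrow>\<^sub>0 'f::field"
    using free_carrier_add[OF that(1) free_carrier_uminus[OF that(2)]] by simp
  have sum: "(\<Sum>i\<in>I. f i) \<in> carrier (free_algebra d)"
    if "finite I" "\<And>i. i \<in> I \<Longrightarrow> f i \<in> carrier (free_algebra d)"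
    for I :: "nat set" and f :: "nat \<Rightarrow> (monomial \<Rightarrow>\<^sub>0 'f::field)"
    using that by (induction I) (auto intro: free_carrier_add free_carrier_zero)
  show ?thesis
    unfolding relators_def
    by (auto intro!: diff sum free_carrier_mult free_carrier_var free_carrier_one free_carrier_zero)
qed

lemma ideal_relation_ideal: "ideal (relation_ideal d) (free_algebra d)"
  unfolding relation_ideal_def
  by (rule ring.genideal_ideal[OF ring_free_algebra relators_carrier])

lemma A_alg_sel:
  "carrier (A_alg d) = carrier (free_algebra d Quot relation_ideal d)"
  "mult (A_alg d) = mult (free_algebra d Quot relation_ideal d)"
  "one (A_alg d) = one (free_algebra d Quot relation_ideal d)"
  "zero (A_alg d) = zero (free_algebra d Quot relation_ideal d)"
  "add (A_alg d) = add (free_algebra d Quot relation_ideal d)"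
  "smult (A_alg d) = (\<lambda>c x. proj d (const c) \<otimes>\<^bsub>A_alg d\<^esub> x)"
  by (simp_all add: A_alg_def Let_def)

lemma ring_A_alg: "ring (A_alg d)"
proof -
  interpret Q: ring "free_algebra d Quot relation_ideal d"
    by (rule ideal.quotient_is_ring[OF ideal_relation_ideal])
  show ?thesis
  proof (rule ringI)
    show "abelian_group (A_alg d)"
      by (rule abelian_groupI)
        (auto simp: A_alg_sel Q.a_ac intro: Q.l_neg Q.a_inv_closed)
    show "Group.monoid (A_alg d)"
      by (rule Group.monoidI) (auto simp: A_alg_sel Q.m_assoc)
  qed (auto simp: A_alg_sel Q.l_distr Q.r_distr)
qed

lemma proj_ring_hom: "proj d \<in> Ring.ring_hom (free_algebra d) (A_alg d)"
  using ideal.rcos_ring_hom[OF ideal_relation_ideal, of d]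
  unfolding Ring.ring_hom_def proj_def A_alg_sel by auto

lemma proj_carrier: "p \<in> carrier (free_algebra d) \<Longrightarrow> proj d p \<in> carrier (A_alg d)"
  using proj_ring_hom by (rule ring_hom_closed)

lemma proj_surj: "carrier (A_alg d) = proj d ` carrier (free_algebra d)"
  unfolding A_alg_sel FactRing_def A_RCOSETS_def' proj_def by auto

lemma proj_eq_iff:
  assumes "p \<in> carrier (free_algebra d)" "q \<in> carrier (free_algebra d)"
  shows "proj d p = proj d q \<longleftrightarrow> p - q \<in> relation_ideal d"
proof -
  interpret F: ring "free_algebra d" by (rule ring_free_algebra)
  have "p \<ominus>\<^bsub>free_algebra d\<^esub> q = p - q"
  proof -
    have "\<ominus>\<^bsub>free_algebra d\<^esub> q = - q"
      by (rule F.minus_equality) (use assms free_carrier_uminus in auto)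
    then show ?thesis by (simp add: a_minus_def)
  qed
  then show ?thesis
    using F.quotient_eq_iff_same_a_r_cos[OF ideal_relation_ideal assms]
    by (simp add: proj_def)
qed

lemma smult_proj:
  assumes "p \<in> carrier (free_algebra d)"
  shows "c \<odot>\<^bsub>A_alg d\<^esub> proj d p = proj d (const c * p)"
  using ring_hom_mult[OF proj_ring_hom free_carrier_const assms, of c] by (simp add: A_alg_sel(6))

lemma vectorspace_A_alg: "vectorspace class_ring (A_alg d :: ('f::field, _) module)"
proof -
  interpret F: ring "free_algebra d :: (monomial \<Rightarrow>\<^sub>0 'f) ring" by (rule ring_free_algebra)
  interpret R: ring "A_alg d :: ('f, _) module" by (rule ring_A_alg)
  have cadd: "proj d (const (a + b)) = proj d (const a) \<oplus>\<^bsub>A_alg d\<^esub> proj d (const b)"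
    for a b :: 'f
    using ring_hom_add[OF proj_ring_hom free_carrier_const free_carrier_const, of d a b]
    by (simp add: const_def single_add)
  have cmult: "proj d (const (a * b)) = proj d (const a) \<otimes>\<^bsub>A_alg d\<^esub> proj d (const b)"
    for a b :: 'f
    using ring_hom_mult[OF proj_ring_hom free_carrier_const free_carrier_const, of d a b]
    by (simp add: const_def mult_single)
  have cone: "proj d (const (1 :: 'f)) = \<one>\<^bsub>A_alg d\<^esub>"
    using ring_hom_one[OF proj_ring_hom[where 'a = 'f], of d]
    by (simp add: const_def)
  have cc: "proj d (const c) \<in> carrier (A_alg d)" for c :: 'f
    by (rule proj_carrier[OF free_carrier_const])
  have "module class_ring (A_alg d :: ('f, _) module)"
    by (rule moduleI)
      (use cc in \<open>auto simp: A_alg_sel(6) R.abelian_group_axioms cadd cmult cone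
          R.l_distr R.r_distr R.m_assoc class_field field.axioms domain.axioms\<close>)
  then show ?thesis
    unfolding vectorspace_def using class_field by blast
qed

lemma const_central: "const c * p = p * const (c :: 'f::field)"
proof (induction p rule: update_induct)
  case const
  then show ?case by simp
next
  case (update p k v)
  have "Poly_Mapping.update k v p = p + Poly_Mapping.single k v"
    using update.hyps
    by (intro poly_mapping_eqI) (auto simp: lookup_update lookup_add lookup_single not_in_keys_iff_lookup_eq_zero)
  moreover have "const c * Poly_Mapping.single k v = Poly_Mapping.single k v * const c"
    by (simp add: const_def mult_single mult.commute)
  ultimately show ?case using update.IH by (simp add: distrib_left distrib_right)
qed

lemma smult_mult:
  assumes "x \<in> carrier (A_alg d)" "y \<in> carrier (A_alg d)"
  shows "(c \<odot>\<^bsub>A_alg d\<^esub> x) \<otimes>\<^bsub>A_alg d\<^esub> y = c \<odot>\<^bsub>A_alg d\<^esub> (x \<otimes>\<^bsub>A_alg d\<^esub> y)"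
    and "x \<otimes>\<^bsub>A_alg d\<^esub> (c \<odot>\<^bsub>A_alg d\<^esub> y) = c \<odot>\<^bsub>A_alg d\<^esub> (x \<otimes>\<^bsub>A_alg d\<^esub> y)"
proof -
  from assms obtain p q where p: "p \<in> carrier (free_algebra d)" "x = proj d p"
    and q: "q \<in> carrier (free_algebra d)" "y = proj d q"
    unfolding proj_surj by blast
  have hom: "proj d r \<otimes>\<^bsub>A_alg d\<^esub> proj d s = proj d (r * s)"
    if "r \<in> carrier (free_algebra d)" "s \<in> carrier (free_algebra d)"
    for r s :: "monomial \<Rightarrow>\<^sub>0 'a"
    using ring_hom_mult[OF proj_ring_hom that] by simp
  note cl = p(1) q(1) free_carrier_mult free_carrier_const
  show "(c \<odot>\<^bsub>A_alg d\<^esub> x) \<otimes>\<^bsub>A_alg d\<^esub> y = c \<odot>\<^bsub>A_alg d\<^esub> (x \<otimes>\<^bsub>A_alg d\<^esub> y)"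
    by (simp add: p(2) q(2) cl smult_proj hom mult.assoc)
  have "p * (const c * q) = const c * (p * q)"
    by (metis const_central mult.assoc)
  then show "x \<otimes>\<^bsub>A_alg d\<^esub> (c \<odot>\<^bsub>A_alg d\<^esub> y) = c \<odot>\<^bsub>A_alg d\<^esub> (x \<otimes>\<^bsub>A_alg d\<^esub> y)"
    by (simp add: p(2) q(2) cl smult_proj hom)
qed

lemma proj_relator: "r \<in> relators d \<Longrightarrow> proj d r = \<zero>\<^bsub>A_alg d\<^esub>"
proof -
  assume r: "r \<in> relators d"
  have "r \<in> relation_ideal d"
    unfolding relation_ideal_def
    using r ring.genideal_self[OF ring_free_algebra relators_carrier] by blast
  then have "proj d r = proj d 0"
    using r relators_carrier by (subst proj_eq_iff) (auto simp: free_carrier_zero)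
  also have "\<dots> = \<zero>\<^bsub>A_alg d\<^esub>"
    using ring_hom_zero[OF proj_ring_hom ring_free_algebra ring_A_alg] by simp
  finally show ?thesis .
qed

end

theory Submission
  imports Defs
begin

text \<open>The algebra acts on the space spanned by the NR words that end with a letter of a fixed kind:
  a generator is prepended to a word, except that a generator of the same kind as the first letter
  acts on it by orthogonality, and \<open>e\<^sub>i\<close> before \<open>e\<^sup>*\<^sub>i\<close> is rewritten as
  \<open>1 - (\<Sum>k\<noteq>i. e\<^sub>k)\<close> (likewise with the kinds exchanged). Applied to the sum \<open>u\<close> of
  the one-letter words, which equals 1 in \<open>A\<close>, an NR word returns itself, so the NR words are
  independent; and each product of generators is congruent to its value on \<open>u\<close>, so they span.
  Words that begin with a given kind are handled by the anti-automorphism reversing all words.\<close>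

section \<open>Linear extension\<close>

text \<open>The linear extension of \<open>f\<close> from the monomial basis; left multiplication by
  \<open>const c\<close> is the scalar action. The vector space underlying the free algebra also
  serves as the space on which the algebra acts.\<close>

definition lext :: "(monomial \<Rightarrow> (monomial \<Rightarrow>\<^sub>0 'f::field)) \<Rightarrow> (monomial \<Rightarrow>\<^sub>0 'f) \<Rightarrow> (monomial \<Rightarrow>\<^sub>0 'f)"
  where "lext f p = (\<Sum>m\<in>Poly_Mapping.keys p. const (Poly_Mapping.lookup p m) * f m)"

lemma const_0 [simp]: "const 0 = 0"
  by (simp add: const_def)

lemma const_1 [simp]: "const 1 = 1"
  by (simp add: const_def)

lemma const_add: "const (a + b) = const a + const b"
  by (simp add: const_def single_add)

lemma const_mult: "const (a * b) = const a * const b"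
  by (simp add: const_def mult_single)

lemma const_times_single: "const a * Poly_Mapping.single m b = Poly_Mapping.single m (a * b)"
  by (simp add: const_def mult_single)

text \<open>Monomials outside the support contribute zero, so two polynomials can be summed over one
  common index set.\<close>

lemma lext_superset:
  assumes "finite S" "Poly_Mapping.keys p \<subseteq> S"
  shows "lext f p = (\<Sum>m\<in>S. const (Poly_Mapping.lookup p m) * f m)"
  unfolding lext_def using assms
  by (intro sum.mono_neutral_left) (auto simp: in_keys_iff)

lemma lext_zero [simp]: "lext f 0 = 0"
  by (simp add: lext_def)

lemma lext_single [simp]: "lext f (Poly_Mapping.single m c) = const c * f m"
  by (simp add: lext_def)

lemma lext_add: "lext f (p + q) = lext f p + lext f q"
proof -
  let ?S = "Poly_Mapping.keys p \<union> Poly_Mapping.keys q"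
  have "Poly_Mapping.keys (p + q) \<subseteq> ?S"
    by (rule Poly_Mapping.keys_add)
  then show ?thesis
    by (simp add: lext_superset[of ?S] lookup_add const_add distrib_right sum.distrib)
qed

text \<open>With \<open>additive_sum\<close>, this yields the rules for differences and sums for
  \<open>lext\<close>, \<open>reversal\<close> and \<open>rep\<close> from additivity alone.\<close>

lemma additive_diff:
  fixes F :: "'a::ab_group_add \<Rightarrow> 'b::ab_group_add"
  assumes "\<And>p q. F (p + q) = F p + F q"
  shows "F (p - q) = F p - F q"
  using assms[of "p - q" q] by (simp add: algebra_simps)

lemma additive_sum:
  fixes F :: "'a::ab_group_add \<Rightarrow> 'b::ab_group_add"
  assumes "\<And>p q. F (p + q) = F p + F q"
  shows "F (sum f S) = (\<Sum>x\<in>S. F (f x))"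
proof -
  have "F 0 = 0"
    using assms[of 0 0] by simp
  then show ?thesis
    by (induction S rule: infinite_finite_induct) (simp_all add: assms)
qed

lemmas lext_diff = additive_diff[where F = "lext f" for f, OF lext_add]
lemmas lext_sum = additive_sum[where F = "lext f" for f, OF lext_add]

lemma poly_single_induct [case_names single add]:
  fixes p :: "'a \<Rightarrow>\<^sub>0 'b::comm_monoid_add"
  assumes single: "\<And>m c. P (Poly_Mapping.single m c)" and add: "\<And>p q. P p \<Longrightarrow> P q \<Longrightarrow> P (p + q)"
  shows "P p"
proof (induction p rule: update_induct)
  case const
  \<comment> \<open>Zero is a single term with coefficient 0, whatever the monomial.\<close>
  show ?case using single[of undefined 0] by simp
next
  case (update p k v)
  have "Poly_Mapping.update k v p = p + Poly_Mapping.single k v"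
    using update.hyps
    by (intro poly_mapping_eqI)
      (auto simp: lookup_update lookup_add lookup_single not_in_keys_iff_lookup_eq_zero)
  then show ?case
    using add[OF update.IH single] by simp
qed

lemma lext_const_mult: "lext f (const c * p) = const c * lext f p"
  by (induction p rule: poly_single_induct)
    (simp_all add: const_times_single const_mult lext_add distrib_left mult.assoc)

text \<open>The condition is confined to the keys of \<open>p\<close> because the map of interest,
  the action on \<open>unit_vector\<close>, is only known to reproduce NR words.\<close>

lemma lext_idI:
  assumes "\<And>m. m \<in> Poly_Mapping.keys p \<Longrightarrow> f m = Poly_Mapping.single m 1"
  shows "lext f p = p"
proof -
  have "lext f p = lext (\<lambda>m. Poly_Mapping.single m 1) p"
    unfolding lext_def using assms by (intro sum.cong) auto
  also have "\<dots> = p"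
    by (induction p rule: poly_single_induct) (simp_all add: lext_add const_times_single)
  finally show ?thesis .
qed

lemma keys_const_mult: "Poly_Mapping.keys (const c * p) \<subseteq> Poly_Mapping.keys p"
  using keys_mult[of "const c" p] by (auto simp: const_def split: if_splits)

section \<open>The relation ideal\<close>

text \<open>Closure under negation comes from absorption, as negation is multiplication by -1. This
  serves to apply the minimality of \<open>relation_ideal\<close> to sets defined by a property of
  their elements.\<close>

lemma ideal_free_algebraI:
  fixes K :: "(monomial \<Rightarrow>\<^sub>0 'f::field) set"
  assumes "K \<subseteq> carrier (free_algebra d)" "0 \<in> K"
    and "\<And>p q. p \<in> K \<Longrightarrow> q \<in> K \<Longrightarrow> p + q \<in> K"
    and l: "\<And>p q. p \<in> carrier (free_algebra d) \<Longrightarrow> q \<in> K \<Longrightarrow> p * q \<in> K"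
    and "\<And>p q. p \<in> K \<Longrightarrow> q \<in> carrier (free_algebra d) \<Longrightarrow> p * q \<in> K"
  shows "ideal K (free_algebra d)"
proof (rule idealI)
  interpret F: ring "free_algebra d :: (monomial \<Rightarrow>\<^sub>0 'f) ring" by (rule ring_free_algebra)
  have "\<ominus>\<^bsub>free_algebra d\<^esub> p \<in> K" if "p \<in> K" for p
  proof -
    have "\<ominus>\<^bsub>free_algebra d\<^esub> p = - p"
      by (rule F.minus_equality) (use assms(1) that free_carrier_uminus in auto)
    also have "\<dots> = - 1 * p" by simp
    also have "\<dots> \<in> K"
      by (intro l that free_carrier_uminus free_carrier_one)
    finally show ?thesis .
  qed
  then show "subgroup K (add_monoid (free_algebra d))"
    using assms by (intro F.add.subgroupI) auto
qed (use assms ring_free_algebra in auto)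

lemma relation_ideal_minimal:
  "ideal K (free_algebra d) \<Longrightarrow> relators d \<subseteq> K \<Longrightarrow> relation_ideal d \<subseteq> K"
  unfolding relation_ideal_def by (rule ring.genideal_minimal[OF ring_free_algebra])

lemma relators_relation_ideal: "relators d \<subseteq> relation_ideal d"
  unfolding relation_ideal_def by (rule ring.genideal_self[OF ring_free_algebra relators_carrier])

lemma relation_ideal_zero: "0 \<in> relation_ideal d"
  using additive_subgroup.zero_closed[OF ideal.axioms(1)[OF ideal_relation_ideal]] by simp

lemma relation_ideal_add:
  "p \<in> relation_ideal d \<Longrightarrow> q \<in> relation_ideal d \<Longrightarrow> p + q \<in> relation_ideal d"
  using additive_subgroup.a_closed[OF ideal.axioms(1)[OF ideal_relation_ideal]] by fastforce

lemma relation_ideal_lmult: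
  "p \<in> carrier (free_algebra d) \<Longrightarrow> q \<in> relation_ideal d \<Longrightarrow> p * q \<in> relation_ideal d"
  using ideal.I_l_closed[OF ideal_relation_ideal] by fastforce

lemma relation_ideal_rmult:
  "p \<in> relation_ideal d \<Longrightarrow> q \<in> carrier (free_algebra d) \<Longrightarrow> p * q \<in> relation_ideal d"
  using ideal.I_r_closed[OF ideal_relation_ideal] by fastforce

lemma relation_ideal_uminus: "p \<in> relation_ideal d \<Longrightarrow> - p \<in> relation_ideal d"
  using relation_ideal_lmult[OF free_carrier_uminus[OF free_carrier_one]] by force

lemma relation_ideal_sum:
  "(\<And>x. x \<in> S \<Longrightarrow> f x \<in> relation_ideal d) \<Longrightarrow> (\<Sum>x\<in>S. f x) \<in> relation_ideal d"
  by (induction S rule: infinite_finite_induct) (auto intro: relation_ideal_zero relation_ideal_add)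

section \<open>Uniform notation for the two kinds of generators, and words as elements\<close>

definition gen :: "bool \<Rightarrow> nat \<Rightarrow> idem"
  where "gen b i = (if b then St i else NS i)"

lemma starred_gen [simp]: "starred (gen b i) = b"
  by (simp add: gen_def)

lemma index_gen [simp]: "index (gen b i) = i"
  by (simp add: gen_def)

lemma gen_starred_index [simp]: "gen (starred g) (index g) = g"
  by (cases g) (simp_all add: gen_def)

lemma gen_eq_iff [simp]: "gen b i = gen c j \<longleftrightarrow> b = c \<and> i = j"
  by (auto simp: gen_def)

lemma idem_eq_iff: "g = h \<longleftrightarrow> starred g = starred h \<and> index g = index h"
  by (cases g; cases h) auto

text \<open>Indexing the relators by the kind \<open>b\<close> lets one argument treat the starred
  and the nonstarred relations together.\<close>

lemma relators_gen: "relators d =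
    {var (gen b i) * var (gen b j) - (if i = j then var (gen b i) else 0) | b i j. i \<le> d \<and> j \<le> d} \<union>
    {1 - (\<Sum>i\<le>d. var (gen b i)) | b. True}"
  unfolding relators_def gen_def by (rule Set.set_eqI) (simp add: ex_bool_eq, blast)

definition wrd :: "idem list \<Rightarrow> (monomial \<Rightarrow>\<^sub>0 'f::field)"
  where "wrd gs = Poly_Mapping.single (Mon gs) 1"

lemma wrd_Cons: "wrd (g # gs) = var g * wrd gs"
  by (simp add: wrd_def var_def mult_single plus_monomial_def)

lemma wrd_Nil: "wrd [] = 1"
  by (simp add: wrd_def flip: zero_monomial_def)

lemma var_wrd: "var g = wrd [g]"
  by (simp add: wrd_def var_def)

lemma single_wrd: "Poly_Mapping.single m c = const c * wrd (letters m)"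
  by (cases m) (simp add: wrd_def const_times_single)

lemma free_carrier_wrd: "(\<And>g. g \<in> set gs \<Longrightarrow> index g \<le> d) \<Longrightarrow> wrd gs \<in> carrier (free_algebra d)"
  by (simp add: free_carrier_iff wrd_def)

lemma lext_wrd: "lext f (wrd gs) = f (Mon gs)"
  by (simp add: wrd_def)

section \<open>Linear complements of the relation ideal\<close>

definition supported :: "idem list set \<Rightarrow> (monomial \<Rightarrow>\<^sub>0 'f::field) set"
  where "supported W = {q. \<forall>m\<in>Poly_Mapping.keys q. letters m \<in> W}"

text \<open>For a linear subspace \<open>M\<close> this says that every class of the quotient has
  exactly one representative in \<open>M\<close>.\<close>

definition complements :: "nat \<Rightarrow> (monomial \<Rightarrow>\<^sub>0 'f::field) set \<Rightarrow> bool"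
  where "complements d M \<longleftrightarrow>
    (\<forall>p\<in>carrier (free_algebra d). \<exists>q\<in>M. p - q \<in> relation_ideal d) \<and> M \<inter> relation_ideal d \<subseteq> {0}"

lemma supported_add: "p \<in> supported W \<Longrightarrow> q \<in> supported W \<Longrightarrow> p + q \<in> supported W"
  unfolding supported_def using Poly_Mapping.keys_add[of p q] by blast

lemma supported_wrd: "gs \<in> W \<Longrightarrow> wrd gs \<in> supported W"
  by (simp add: supported_def wrd_def)

lemma supported_const_mult: "p \<in> supported W \<Longrightarrow> const c * p \<in> supported W"
  unfolding supported_def using keys_const_mult[of c p] by blast

lemma supported_mono: "W \<subseteq> V \<Longrightarrow> supported W \<subseteq> supported V"
  by (auto simp: supported_def)

lemma supported_zero: "0 \<in> supported W"
  by (simp add: supported_def)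

lemma supported_diff:
  assumes "p \<in> supported W" "q \<in> supported W" shows "p - q \<in> supported W"
proof -
  have "- q \<in> supported W"
    using assms(2) by (simp add: supported_def)
  from supported_add[OF assms(1) this] show ?thesis by simp
qed

lemma supported_sum:
  "(\<And>x. x \<in> S \<Longrightarrow> f x \<in> supported W) \<Longrightarrow> (\<Sum>x\<in>S. f x) \<in> supported W"
  by (induction S rule: infinite_finite_induct) (auto intro: supported_zero supported_add)

lemma supported_lext:
  "p \<in> supported W \<Longrightarrow> (\<And>m. letters m \<in> W \<Longrightarrow> f m \<in> supported V) \<Longrightarrow> lext f p \<in> supported V"
  unfolding lext_def
  by (intro supported_sum supported_const_mult) (auto simp: supported_def)

lemma supported_carrier:
  "(\<And>gs g. gs \<in> W \<Longrightarrow> g \<in> set gs \<Longrightarrow> index g \<le> d) \<Longrightarrow> supported W \<subseteq> carrier (free_algebra d)"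
  by (fastforce simp: supported_def free_carrier_iff)

section \<open>From a complement of the ideal to a basis of the quotient\<close>

lemma word_product_eq:
  "(\<And>g. g \<in> set gs \<Longrightarrow> index g \<le> d) \<Longrightarrow>
    (word_product d gs :: (monomial \<Rightarrow>\<^sub>0 'f::field) set) = proj d (wrd gs)"
proof (induction gs)
  case Nil
  then show ?case
    using ring_hom_one[OF proj_ring_hom[where 'a = 'f], of d]
    by (simp add: word_product_def wrd_Nil)
next
  case (Cons g gs)
  then have "var g \<in> carrier (free_algebra d :: (monomial \<Rightarrow>\<^sub>0 'f) ring)"
    and "wrd gs \<in> carrier (free_algebra d :: (monomial \<Rightarrow>\<^sub>0 'f) ring)"
    by (auto intro: free_carrier_var free_carrier_wrd)
  from ring_hom_mult[OF proj_ring_hom this] Cons show ?case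
    by (simp add: word_product_def wrd_Cons idem_gen_def)
qed

text \<open>Existence of representatives in the span of \<open>W\<close> gives spanning; the trivial
  intersection with the ideal gives independence.\<close>

lemma basis_word_product:
  fixes W :: "idem list set"
  assumes ind: "\<And>gs g. gs \<in> W \<Longrightarrow> g \<in> set gs \<Longrightarrow> index g \<le> d"
    and comp: "complements d (supported W :: (monomial \<Rightarrow>\<^sub>0 'f::field) set)"
  shows "vectorspace.basis class_ring (A_alg d :: ('f, _) module) (word_product d ` W)"
proof -
  let ?A = "A_alg d :: ('f, _) module"
  let ?w = "\<lambda>gs. proj d (wrd gs) :: (monomial \<Rightarrow>\<^sub>0 'f) set"
  interpret V: vectorspace class_ring ?A by (rule vectorspace_A_alg)
  have carr: "q \<in> carrier (free_algebra d)" if "q \<in> supported W" for q :: "monomial \<Rightarrow>\<^sub>0 'f"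
    using supported_carrier[of W d] ind that by blast
  have hom_zero: "proj d 0 = \<zero>\<^bsub>?A\<^esub>"
    using ring_hom_zero[OF proj_ring_hom ring_free_algebra ring_A_alg] by simp
  have eq: "word_product d ` W = ?w ` W"
    by (intro image_cong word_product_eq ind refl)
  have sub: "?w ` W \<subseteq> carrier ?A"
    by (auto intro!: proj_carrier carr supported_wrd)
  have zero: "q = 0" if "q \<in> supported W" "q \<in> relation_ideal d" for q :: "monomial \<Rightarrow>\<^sub>0 'f"
    using comp that by (auto simp: complements_def)
  \<comment> \<open>A basis is a set of classes here, so distinct words must have distinct classes
    before sums over words can be read as linear combinations of classes.\<close>
  have inj: "inj_on ?w W"
  proof (rule inj_onI)
    fix gs hs assume *: "gs \<in> W" "hs \<in> W" "?w gs = ?w hs"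
    then have "(wrd gs - wrd hs :: monomial \<Rightarrow>\<^sub>0 'f) \<in> relation_ideal d"
      using proj_eq_iff[OF carr carr] supported_wrd by blast
    then have "(wrd gs - wrd hs :: monomial \<Rightarrow>\<^sub>0 'f) = 0"
      using * by (intro zero supported_diff supported_wrd)
    then have "Poly_Mapping.lookup (wrd gs :: monomial \<Rightarrow>\<^sub>0 'f) (Mon gs) =
      Poly_Mapping.lookup (wrd hs) (Mon gs)" by simp
    then show "gs = hs"
      by (simp add: wrd_def lookup_single when_def split: if_splits)
  qed
  have lincomb: "V.lincomb a (?w ` L) = proj d (\<Sum>gs\<in>L. const (a (?w gs)) * wrd gs)"
    if "finite L" "L \<subseteq> W" for a L
    using that
  proof (induction L)
    case empty
    then show ?case by (simp add: V.lincomb_def hom_zero)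
  next
    case (insert gs L)
    have w: "wrd gs \<in> carrier (free_algebra d :: (monomial \<Rightarrow>\<^sub>0 'f) ring)"
      using insert.prems by (intro carr supported_wrd) auto
    have s: "(\<Sum>gs\<in>L. const (a (?w gs)) * wrd gs) \<in> carrier (free_algebra d)"
      using insert.prems by (intro carr supported_sum supported_const_mult supported_wrd) auto
    have "?w gs \<notin> ?w ` L"
      using insert.hyps insert.prems inj by (auto simp: inj_on_def)
    moreover have "?w ` insert gs L \<subseteq> carrier ?A"
      using sub insert.prems by auto
    ultimately have "V.lincomb a (?w ` insert gs L) =
        a (?w gs) \<odot>\<^bsub>?A\<^esub> ?w gs \<oplus>\<^bsub>?A\<^esub> V.lincomb a (?w ` L)"
      unfolding V.lincomb_def image_insert using insert.hyps
      by (intro V.M.finsum_insert) (auto intro!: V.smult_closed)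
    also have "\<dots> = proj d (const (a (?w gs)) * wrd gs) \<oplus>\<^bsub>?A\<^esub>
        proj d (\<Sum>gs\<in>L. const (a (?w gs)) * wrd gs)"
      using insert.IH insert.prems by (simp add: smult_proj[OF w])
    also have "\<dots> = proj d (\<Sum>gs\<in>insert gs L. const (a (?w gs)) * wrd gs)"
      using ring_hom_add[OF proj_ring_hom free_carrier_mult[OF free_carrier_const w] s] insert.hyps
      by simp
    finally show ?case .
  qed
  have supp: "(\<Sum>gs\<in>L. const (b gs) * wrd gs) \<in> supported W" if "L \<subseteq> W"
    for L and b :: "idem list \<Rightarrow> 'f"
    using that by (intro supported_sum supported_const_mult supported_wrd) auto
  have "V.lin_indpt (?w ` W)"
  proof
    assume "V.lin_dep (?w ` W)"
    then obtain B a v where B: "finite B" "B \<subseteq> ?w ` W" "V.lincomb a B = \<zero>\<^bsub>?A\<^esub>"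
      and v: "v \<in> B" "a v \<noteq> 0"
      unfolding V.lin_dep_def by auto
    \<comment> \<open>Injectivity of \<open>?w\<close> on \<open>W\<close> makes the set of words
      over the finite set \<open>B\<close> finite as well.\<close>
    then obtain L where L: "L \<subseteq> W" "B = ?w ` L" and "finite L"
      using inj by (metis finite_imageD inj_on_subset subset_image_inj)
    define q where "q = (\<Sum>gs\<in>L. const (a (?w gs)) * wrd gs)"
    have q: "q \<in> supported W"
      unfolding q_def by (intro supp L)
    have "proj d q = proj d 0"
      using B(3) lincomb[OF \<open>finite L\<close> L(1)] hom_zero by (simp add: L q_def)
    then have "q \<in> relation_ideal d"
      using proj_eq_iff[OF carr[OF q] free_carrier_zero] by simp
    then have "q = 0" by (intro zero q)
    from v(1) L obtain gs where gs: "gs \<in> L" "v = ?w gs" by auto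
    have "Poly_Mapping.lookup q (Mon gs) = a v"
      using gs \<open>finite L\<close>
      by (simp add: q_def lookup_sum wrd_def const_times_single lookup_single when_def sum.delta)
    with v \<open>q = 0\<close> show False by simp
  qed
  moreover have "V.span (?w ` W) = carrier ?A"
  proof
    show "V.span (?w ` W) \<subseteq> carrier ?A"
      by (rule V.span_is_subset2[OF sub])
    show "carrier ?A \<subseteq> V.span (?w ` W)"
    proof
      fix x assume "x \<in> carrier ?A"
      then obtain p where p: "p \<in> carrier (free_algebra d)" "x = proj d p"
        unfolding proj_surj by blast
      then obtain q where q: "q \<in> supported W" "p - q \<in> relation_ideal d"
        using comp by (auto simp: complements_def)
      define L where "L = letters ` Poly_Mapping.keys q"
      have L: "L \<subseteq> W" "finite L"
        using q(1) by (auto simp: supported_def L_def)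
      \<comment> \<open>Coefficients are attached to classes, so those of \<open>q\<close> are
        transported along the inverse of the injection \<open>?w\<close>.\<close>
      define a where "a = (\<lambda>v. Poly_Mapping.lookup q (Mon (the_inv_into W ?w v)))"
      have "q = lext (\<lambda>m. Poly_Mapping.single m 1) q"
        by (simp add: lext_idI)
      also have "\<dots> = (\<Sum>gs\<in>L. const (Poly_Mapping.lookup q (Mon gs)) * wrd gs)"
        unfolding lext_def L_def
        by (subst sum.reindex) (auto simp: inj_on_def monomial.expand wrd_def)
      also have "\<dots> = (\<Sum>gs\<in>L. const (a (?w gs)) * wrd gs)"
        using L(1) by (intro sum.cong) (auto simp: a_def the_inv_into_f_f[OF inj] subset_iff)
      finally have "V.lincomb a (?w ` L) = proj d q"
        using lincomb[OF L(2,1)] by simp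
      also have "\<dots> = x"
        using proj_eq_iff[OF p(1) carr[OF q(1)]] p(2) q(2) by simp
      finally show "x \<in> V.span (?w ` W)"
        unfolding V.span_def using L by auto
    qed
  qed
  ultimately show ?thesis
    unfolding eq V.basis_def using sub by blast
qed

section \<open>Reversal\<close>

definition reversal :: "(monomial \<Rightarrow>\<^sub>0 'f::field) \<Rightarrow> (monomial \<Rightarrow>\<^sub>0 'f)"
  where "reversal = lext (\<lambda>m. wrd (rev (letters m)))"

lemma reversal_add: "reversal (p + q) = reversal p + reversal q"
  by (simp add: reversal_def lext_add)

lemmas reversal_diff = additive_diff[where F = reversal, OF reversal_add]
lemmas reversal_sum = additive_sum[where F = reversal, OF reversal_add]

lemma reversal_wrd: "reversal (wrd gs) = wrd (rev gs)"
  by (simp add: reversal_def lext_wrd)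

lemma reversal_single:
  "reversal (Poly_Mapping.single m c) = Poly_Mapping.single (Mon (rev (letters m))) c"
  by (simp add: reversal_def wrd_def const_times_single)

lemma reversal_reversal [simp]: "reversal (reversal p) = p"
  by (induction p rule: poly_single_induct) (simp_all add: reversal_add reversal_single)

text \<open>Both sides are additive in each factor, so it suffices to reverse a concatenation of two
  monomials; the scalars commute.\<close>

lemma reversal_mult: "reversal (p * q) = reversal q * reversal p"
proof (induction p rule: poly_single_induct)
  case (single m c)
  show ?case
  proof (induction q rule: poly_single_induct)
    case (single n e)
    show ?case
      by (simp add: mult_single reversal_single plus_monomial_def mult.commute)
  qed (simp add: distrib_left distrib_right reversal_add)
qed (simp add: distrib_left distrib_right reversal_add)

lemma reversal_supported: "p \<in> supported W \<Longrightarrow> reversal p \<in> supported (rev ` W)"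
  unfolding reversal_def by (erule supported_lext) (auto intro: supported_wrd)

lemma free_carrier_supported:
  "carrier (free_algebra d) = supported {gs. \<forall>g\<in>set gs. index g \<le> d}"
  by (auto simp: free_carrier_iff supported_def)

lemma reversal_carrier:
  assumes "p \<in> carrier (free_algebra d)" shows "reversal p \<in> carrier (free_algebra d)"
proof -
  have "rev ` {gs. \<forall>g\<in>set gs. index g \<le> d} \<subseteq> {gs. \<forall>g\<in>set gs. index g \<le> d}"
    by auto
  then show ?thesis
    using supported_mono reversal_supported assms unfolding free_carrier_supported by blast
qed

text \<open>The preimage of a two-sided ideal under an anti-automorphism is again a two-sided ideal.
  It contains the relators, since reversal permutes them, so minimality applies.\<close>

lemma reversal_relation_ideal:
  assumes "p \<in> relation_ideal d" shows "reversal p \<in> relation_ideal d"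
proof -
  define K :: "(monomial \<Rightarrow>\<^sub>0 'a) set"
    where "K = {p \<in> carrier (free_algebra d). reversal p \<in> relation_ideal d}"
  have var: "reversal (var g) = var g" for g :: idem
    by (simp add: var_wrd reversal_wrd)
  have "reversal r \<in> relators d" if "r \<in> relators d" for r :: "monomial \<Rightarrow>\<^sub>0 'a"
    using that[unfolded relators_gen]
  proof (elim UnE CollectE exE conjE)
    fix b i j assume "i \<le> d" "j \<le> d"
      and r: "r = var (gen b i) * var (gen b j) - (if i = j then var (gen b i) else 0)"
    \<comment> \<open>Reversal exchanges \<open>i\<close> and \<open>j\<close>; the subtracted term
      is nonzero only for \<open>i = j\<close>, where the exchange changes nothing.\<close>
    have "reversal r = var (gen b j) * var (gen b i) - (if j = i then var (gen b j) else 0)"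
      by (simp add: r reversal_diff reversal_mult var) (simp add: reversal_def)
    with \<open>i \<le> d\<close> \<open>j \<le> d\<close> show "reversal r \<in> relators d"
      unfolding relators_gen by blast
  next
    fix b assume r: "r = 1 - (\<Sum>i\<le>d. var (gen b i))"
    have "reversal r = r"
      using reversal_wrd[of "[]", where 'a='a] by (simp add: r reversal_diff reversal_sum var wrd_Nil)
    with r show "reversal r \<in> relators d"
      unfolding relators_gen by blast
  qed
  then have "relators d \<subseteq> K"
    unfolding K_def using relators_carrier relators_relation_ideal by blast
  moreover have "ideal K (free_algebra d)"
    unfolding K_def
    by (rule ideal_free_algebraI)
      (auto simp: reversal_add reversal_mult free_carrier_zero relation_ideal_zero
          reversal_def[THEN fun_cong, of 0]
        intro: free_carrier_add free_carrier_mult relation_ideal_add relation_ideal_lmult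
          relation_ideal_rmult reversal_carrier)
  ultimately show ?thesis
    using relation_ideal_minimal assms unfolding K_def by blast
qed

text \<open>Reversal is a linear involution that preserves the free algebra and the ideal, hence it
  carries complements to complements.\<close>

lemma complements_rev:
  assumes "complements d (supported W :: (monomial \<Rightarrow>\<^sub>0 'f::field) set)"
  shows "complements d (supported (rev ` W) :: (monomial \<Rightarrow>\<^sub>0 'f) set)"
  unfolding complements_def
proof (intro conjI ballI subsetI)
  fix p :: "monomial \<Rightarrow>\<^sub>0 'f" assume "p \<in> carrier (free_algebra d)"
  with assms obtain q where "q \<in> supported W" "reversal p - q \<in> relation_ideal d"
    unfolding complements_def using reversal_carrier by blast
  then show "\<exists>q\<in>supported (rev ` W). p - q \<in> relation_ideal d"
    using reversal_supported reversal_relation_ideal by (metis reversal_diff reversal_reversal)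
next
  fix q :: "monomial \<Rightarrow>\<^sub>0 'f" assume "q \<in> supported (rev ` W) \<inter> relation_ideal d"
  then have "reversal q \<in> supported W \<inter> relation_ideal d"
    using reversal_supported[of q "rev ` W"] reversal_relation_ideal by (auto simp: image_image)
  then have "reversal q = 0"
    using assms by (auto simp: complements_def)
  then show "q \<in> {0}"
    by (metis lext_zero reversal_def reversal_reversal singletonI)
qed

section \<open>The left action on the span of words\<close>

text \<open>The first case makes the idempotents act on words without a valid first letter (such as the
  empty one) through the character that sends the generators of index 0 to 1 and all others to 0. With
  it the defining relations hold on the whole free algebra, so no invariant subspace has to be
  carried along. The last case comes from rewriting \<open>e\<^sub>i = 1 - (\<Sum>k\<noteq>i. e\<^sub>k)\<close>.\<close>

definition step :: "nat \<Rightarrow> idem \<Rightarrow> monomial \<Rightarrow> (monomial \<Rightarrow>\<^sub>0 'f::field)"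
  where "step d g m = (let w = letters m in
    if w = [] \<or> index (hd w) > d then (if index g = 0 then wrd w else 0)
    else if starred g = starred (hd w) then (if g = hd w then wrd w else 0)
    else if index g \<noteq> index (hd w) then wrd (g # w)
    else wrd w - (\<Sum>k\<in>{..d} - {index g}. wrd (gen (starred g) k # w)))"

text \<open>The orthogonality relations hold for the operators \<open>step\<close>, checked on each
  monomial.\<close>

lemma step_idem:
  assumes "i \<le> d" "j \<le> d"
  shows "lext (step d (gen b i)) (step d (gen b j) m) =
    (if i = j then step d (gen b i) m else 0 :: monomial \<Rightarrow>\<^sub>0 'f::field)"
proof (cases "letters m = [] \<or> index (hd (letters m)) > d \<or> b = starred (hd (letters m))")
  \<comment> \<open>Here \<open>m\<close> is an eigenvector of both operators, with eigenvalues 0 or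
    1.\<close>
  case True
  then show ?thesis
    by (cases "letters m = [] \<or> index (hd (letters m)) > d")
      (auto simp: step_def Let_def lext_wrd idem_eq_iff)
next
  case False
  let ?w = "letters m"
  have step_gen: "step d (gen b i) (Mon (gen b k # ?w)) = (if k = i then wrd (gen b k # ?w) else 0)"
    if "k \<le> d" for k
    using that by (simp add: step_def)
  show ?thesis
  proof (cases "j = index (hd ?w)")
    case True
    have eq: "step d (gen b j) m = wrd ?w - (\<Sum>k\<in>{..d} - {j}. wrd (gen b k # ?w))"
      using False True by (simp add: step_def Let_def)
    \<comment> \<open>Applying \<open>e_i\<close> to the rewritten word keeps only the summand with
      \<open>k = i\<close>. For \<open>i = j\<close> there is none; for \<open>i \<noteq> j\<close>
      it equals \<open>step d (gen b i) m\<close> and cancels it.\<close>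
    have "lext (step d (gen b i)) (step d (gen b j) m) = step d (gen b i) m -
        (\<Sum>k\<in>{..d} - {j}. if k = i then wrd (gen b k # ?w) else 0 :: monomial \<Rightarrow>\<^sub>0 'f)"
      by (simp add: eq lext_diff lext_sum step_gen lext_wrd)
    then have "lext (step d (gen b i)) (step d (gen b j) m) =
        step d (gen b i) m - (if i = j then 0 else wrd (gen b i # ?w) :: monomial \<Rightarrow>\<^sub>0 'f)"
      using assms by simp
    moreover have "step d (gen b i) m = (wrd (gen b i # ?w) :: monomial \<Rightarrow>\<^sub>0 'f)" if "i \<noteq> j"
      using False True that by (simp add: step_def Let_def)
    ultimately show ?thesis by simp
  next
    case neq: False
    then have eq: "step d (gen b j) m = wrd (gen b j # ?w)"
      using False by (simp add: step_def Let_def)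
    show ?thesis
      using assms by (simp add: eq step_gen lext_wrd)
  qed
qed

text \<open>The relation that the idempotents of one kind sum to 1. If the first letter is valid and
  of the other kind, the rewritten term is by construction the word minus all the other
  terms.\<close>

lemma step_sum: "(\<Sum>i\<le>d. step d (gen b i) m) = wrd (letters m)"
proof (cases "letters m = [] \<or> index (hd (letters m)) > d")
  case True
  then have "(\<Sum>i\<le>d. step d (gen b i) m) = (\<Sum>i\<le>d. if i = 0 then wrd (letters m) else 0)"
    by (intro sum.cong) (auto simp: step_def)
  then show ?thesis by simp
next
  case False
  let ?w = "letters m"
  let ?h = "index (hd ?w)"
  show ?thesis
  proof (cases "b = starred (hd ?w)")
    case True
    then have "(\<Sum>i\<le>d. step d (gen b i) m) = (\<Sum>i\<le>d. if i = ?h then wrd ?w else 0)"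
      using False by (intro sum.cong) (auto simp: step_def idem_eq_iff)
    then show ?thesis using False by simp
  next
    case neq: False
    have "(\<Sum>i\<le>d. step d (gen b i) m) =
        step d (gen b ?h) m + (\<Sum>i\<in>{..d} - {?h}. step d (gen b i) m)"
      using False by (intro sum.remove) auto
    also have "(\<Sum>i\<in>{..d} - {?h}. step d (gen b i) m) = (\<Sum>i\<in>{..d} - {?h}. wrd (gen b i # ?w))"
      using False neq by (intro sum.cong) (auto simp: step_def)
    also have "step d (gen b ?h) m = wrd ?w - (\<Sum>i\<in>{..d} - {?h}. wrd (gen b i # ?w))"
      using False neq by (simp add: step_def Let_def)
    finally show ?thesis by simp
  qed
qed

section \<open>The representation of the free algebra and its kernel\<close>

definition act :: "nat \<Rightarrow> idem list \<Rightarrow> (monomial \<Rightarrow>\<^sub>0 'f::field) \<Rightarrow> (monomial \<Rightarrow>\<^sub>0 'f)"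
  where "act d gs v = foldr (\<lambda>g. lext (step d g)) gs v"

lemma act_simps [simp]:
  "act d [] v = v" "act d (g # gs) v = lext (step d g) (act d gs v)"
  "act d (gs @ hs) v = act d gs (act d hs v)"
  by (simp_all add: act_def)

lemma act_add: "act d gs (u + v) = act d gs u + act d gs v"
  by (induction gs) (simp_all add: lext_add)

lemma act_const_mult: "act d gs (const c * v) = const c * act d gs v"
  by (induction gs) (simp_all add: lext_const_mult)

definition rep :: "nat \<Rightarrow> (monomial \<Rightarrow>\<^sub>0 'f::field) \<Rightarrow> (monomial \<Rightarrow>\<^sub>0 'f) \<Rightarrow> (monomial \<Rightarrow>\<^sub>0 'f)"
  where "rep d p v = lext (\<lambda>m. act d (letters m) v) p"

lemma rep_add_left: "rep d (p + q) v = rep d p v + rep d q v"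
  by (simp add: rep_def lext_add)

lemmas rep_diff_left = additive_diff[where F = "\<lambda>p. rep d p v" for d v, OF rep_add_left]
lemmas rep_sum_left = additive_sum[where F = "\<lambda>p. rep d p v" for d v, OF rep_add_left]

lemma rep_single: "rep d (Poly_Mapping.single m c) v = const c * act d (letters m) v"
  by (simp add: rep_def)

lemma rep_wrd: "rep d (wrd gs) v = act d gs v"
  by (simp add: rep_def lext_wrd)

lemma rep_zero_left [simp]: "rep d 0 v = 0"
  by (simp add: rep_def)

lemma rep_add_right: "rep d p (u + v) = rep d p u + rep d p v"
  by (simp add: rep_def lext_def act_add distrib_left sum.distrib)

lemma rep_zero_right [simp]: "rep d p 0 = 0"
  using rep_add_right[of d p 0 0] by simp

text \<open>By additivity this reduces to monomials, where concatenation acts as composition of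
  operators.\<close>

lemma rep_mult: "rep d (p * q) v = rep d p (rep d q v)"
proof (induction p rule: poly_single_induct)
  case (single m c)
  show ?case
  proof (induction q rule: poly_single_induct)
    case (single n e)
    show ?case
      by (simp add: mult_single rep_single plus_monomial_def act_const_mult const_mult mult.assoc)
  qed (simp add: distrib_left rep_add_left rep_add_right)
qed (simp add: distrib_right rep_add_left)

text \<open>The action factors through the quotient: its annihilator is a two-sided ideal, which
  contains the relators by \<open>step_idem\<close> and \<open>step_sum\<close>.\<close>

lemma rep_relation_ideal:
  fixes p :: "monomial \<Rightarrow>\<^sub>0 'f::field"
  assumes "p \<in> relation_ideal d" shows "rep d p v = 0"
proof -
  define K :: "(monomial \<Rightarrow>\<^sub>0 'f) set"
    \<comment> \<open>Quantifying over all \<open>v\<close> gives closure under right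
      multiplication, because \<open>p * q\<close> acts on \<open>v\<close> as \<open>p\<close> acts
      on \<open>rep d q v\<close>.\<close>
    where "K = {p \<in> carrier (free_algebra d). \<forall>v. rep d p v = 0}"
  have var: "rep d (var g) u = lext (step d g) u" for g and u :: "monomial \<Rightarrow>\<^sub>0 'f"
    by (simp add: var_wrd rep_wrd)
  have "rep d r u = 0" if "r \<in> relators d" for r u :: "monomial \<Rightarrow>\<^sub>0 'f"
    using that unfolding relators_gen
  proof (elim UnE CollectE exE conjE)
    fix b i j assume "i \<le> d" "j \<le> d"
      and r: "r = var (gen b i) * var (gen b j) - (if i = j then var (gen b i) else 0)"
    have "rep d (var (gen b i) * var (gen b j)) u = rep d (if i = j then var (gen b i) else 0) u"
    proof (induction u rule: poly_single_induct)
      case (single m c)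
      show ?case
        by (cases "i = j") (simp_all add: rep_mult var lext_const_mult step_idem \<open>i \<le> d\<close> \<open>j \<le> d\<close>)
    qed (simp add: rep_add_right)
    then show ?thesis
      by (simp add: r rep_diff_left)
  next
    fix b assume r: "r = 1 - (\<Sum>i\<le>d. var (gen b i))"
    have "(\<Sum>i\<le>d. rep d (var (gen b i)) u) = u"
    proof (induction u rule: poly_single_induct)
      case (single m c)
      show ?case
        by (simp add: var step_sum flip: sum_distrib_left) (simp add: single_wrd)
    qed (simp add: rep_add_right sum.distrib)
    moreover have "rep d 1 u = u"
      by (simp add: rep_wrd flip: wrd_Nil)
    ultimately show ?thesis
      by (simp add: r rep_diff_left rep_sum_left)
  qed
  then have "relators d \<subseteq> K"
    unfolding K_def using relators_carrier by blast
  moreover have "ideal K (free_algebra d)"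
    unfolding K_def
    by (rule ideal_free_algebraI)
      (auto simp: rep_add_left rep_mult free_carrier_zero intro: free_carrier_add free_carrier_mult)
  ultimately show ?thesis
    using relation_ideal_minimal assms unfolding K_def by blast
qed

section \<open>Nonrepeating words\<close>

definition NR_ending :: "nat \<Rightarrow> bool \<Rightarrow> idem list set"
  where "NR_ending d b = {gs. is_word d gs \<and> nonrepeating gs \<and> starred (last gs) = b}"

lemma NR_ending_index: "gs \<in> NR_ending d b \<Longrightarrow> g \<in> set gs \<Longrightarrow> index g \<le> d"
  by (auto simp: NR_ending_def is_word_def)

lemma NR_ending_hd: "gs \<in> NR_ending d b \<Longrightarrow> gs \<noteq> [] \<and> index (hd gs) \<le> d"
  by (auto simp: NR_ending_def is_word_def)

lemma NR_ending_singleton: "[g] \<in> NR_ending d b \<longleftrightarrow> index g \<le> d \<and> starred g = b"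
  by (auto simp: NR_ending_def is_word_def nonrepeating_def)

lemma NR_ending_Cons:
  "gs \<noteq> [] \<Longrightarrow> g # gs \<in> NR_ending d b \<longleftrightarrow>
    gs \<in> NR_ending d b \<and> index g \<le> d \<and> starred g \<noteq> starred (hd gs) \<and> index g \<noteq> index (hd gs)"
  by (auto simp: NR_ending_def is_word_def nonrepeating_def successively_Cons)

text \<open>Every letter that \<open>step\<close> prepends here differs from the first letter in
  both kind and index, and the last letter stays the same.\<close>

lemma step_supported:
  assumes "gs \<in> NR_ending d b" "index g \<le> d"
  shows "step d g (Mon gs) \<in> supported (NR_ending d b)"
  using assms NR_ending_hd[OF assms(1)]
  by (auto simp: step_def NR_ending_Cons intro!: supported_diff supported_sum supported_wrd supported_zero)

text \<open>Modulo the ideal, \<open>step\<close> is left multiplication: for equal kinds by an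
  orthogonality relator times the tail, for equal indices of different kinds by a sum relator times
  the word, otherwise by equality. The hypotheses on \<open>gs\<close> exclude the artificial case
  of \<open>step\<close>.\<close>

lemma step_cong:
  assumes "gs \<noteq> []" "\<And>h. h \<in> set gs \<Longrightarrow> index h \<le> d" "index g \<le> d"
  shows "var g * wrd gs - (step d g (Mon gs) :: monomial \<Rightarrow>\<^sub>0 'f::field) \<in> relation_ideal d"
proof -
  let ?I = "relation_ideal d :: (monomial \<Rightarrow>\<^sub>0 'f) set"
  obtain h hs where gs: "gs = h # hs"
    using assms(1) by (cases gs) auto
  have carr: "wrd gs \<in> carrier (free_algebra d :: (monomial \<Rightarrow>\<^sub>0 'f) ring)"
      "wrd hs \<in> carrier (free_algebra d :: (monomial \<Rightarrow>\<^sub>0 'f) ring)"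
    using assms by (auto simp: gs intro!: free_carrier_wrd)
  have h: "index h \<le> d"
    using assms by (simp add: gs)
  show ?thesis
  proof (cases "starred g = starred h")
    case True
    let ?r = "\<lambda>i j. var (gen (starred g) i) * var (gen (starred g) j) -
      (if i = j then var (gen (starred g) i) else 0) :: monomial \<Rightarrow>\<^sub>0 'f"
    have gen: "gen (starred g) (index h) = h" and eq: "index g = index h \<longleftrightarrow> g = h"
      using True by (simp_all add: idem_eq_iff)
    have "?r (index g) (index h) \<in> relators d"
      unfolding relators_gen using assms(3) h by blast
    then have "var g * var h - (if g = h then var g else 0) \<in> (relators d :: (monomial \<Rightarrow>\<^sub>0 'f) set)"
      unfolding gen_starred_index gen eq .
    then have "(var g * var h - (if g = h then var g else 0)) * wrd hs \<in> ?I"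
      using relators_relation_ideal carr by (blast intro: relation_ideal_rmult)
    then show ?thesis
      using True h by (auto simp: gs step_def wrd_Cons left_diff_distrib mult.assoc split: if_splits)
  next
    case False
    show ?thesis
    proof (cases "index g = index h")
      case eq: True
      let ?s = "starred g"
      have "1 - (\<Sum>i\<le>d. var (gen ?s i)) \<in> ?I"
        using relators_relation_ideal unfolding relators_gen by blast
      then have I: "(1 - (\<Sum>i\<le>d. var (gen ?s i))) * wrd gs \<in> ?I"
        using carr by (rule_tac relation_ideal_rmult)
      have "(\<Sum>i\<le>d. wrd (gen ?s i # gs)) =
          (wrd (g # gs) :: monomial \<Rightarrow>\<^sub>0 'f) + (\<Sum>k\<in>{..d} - {index g}. wrd (gen ?s k # gs))"
        using assms(3) by (subst sum.remove[of _ "index g"]) auto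
      then have "(1 - (\<Sum>i\<le>d. var (gen ?s i))) * wrd gs =
          - (var g * wrd gs - (step d g (Mon gs) :: monomial \<Rightarrow>\<^sub>0 'f))"
        using eq False h by (simp add: gs step_def left_diff_distrib sum_distrib_right wrd_Cons)
      with I show ?thesis
        using relation_ideal_uminus by fastforce
    next
      case neq: False
      then show ?thesis
        using False h by (simp add: gs step_def wrd_Cons relation_ideal_zero)
    qed
  qed
qed

lemma lext_step_cong:
  assumes "p \<in> supported (NR_ending d b)" "index g \<le> d"
  shows "var g * p - lext (step d g) p \<in> relation_ideal d"
proof -
  have "p = lext (\<lambda>m. wrd (letters m)) p"
    by (rule lext_idI[symmetric]) (simp add: wrd_def)
  \<comment> \<open>Scalars are central, so they move to the left of \<open>var g\<close>.\<close>
  then have "var g * p = (\<Sum>m\<in>Poly_Mapping.keys p.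
      const (Poly_Mapping.lookup p m) * (var g * wrd (letters m)))"
    unfolding lext_def by (metis (no_types, lifting) const_central mult.assoc sum.cong sum_distrib_left)
  then have "var g * p - lext (step d g) p = (\<Sum>m\<in>Poly_Mapping.keys p.
      const (Poly_Mapping.lookup p m) * (var g * wrd (letters m) - step d g m))"
    by (simp add: lext_def right_diff_distrib sum_subtractf)
  also have "\<dots> \<in> relation_ideal d"
  proof (intro relation_ideal_sum relation_ideal_lmult free_carrier_const)
    fix m assume "m \<in> Poly_Mapping.keys p"
    then have "letters m \<in> NR_ending d b"
      using assms(1) by (simp add: supported_def)
    then show "var g * wrd (letters m) - step d g m \<in> relation_ideal d"
      using step_cong[of "letters m" d g] NR_ending_hd NR_ending_index assms(2) by fastforce
  qed
  finally show ?thesis .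
qed

text \<open>The image of 1 in the module spanned by the words ending with the given kind of letter.\<close>

definition unit_vector :: "nat \<Rightarrow> bool \<Rightarrow> (monomial \<Rightarrow>\<^sub>0 'f::field)"
  where "unit_vector d b = (\<Sum>i\<le>d. wrd [gen b i])"

lemma unit_vector_supported: "unit_vector d b \<in> supported (NR_ending d b)"
  unfolding unit_vector_def by (intro supported_sum supported_wrd) (simp add: NR_ending_singleton)

lemma act_unit_vector_supported:
  "(\<And>g. g \<in> set gs \<Longrightarrow> index g \<le> d) \<Longrightarrow>
    (act d gs (unit_vector d b) :: monomial \<Rightarrow>\<^sub>0 'f::field) \<in> supported (NR_ending d b)"
proof (induction gs)
  case (Cons g gs)
  let ?v = "act d gs (unit_vector d b) :: monomial \<Rightarrow>\<^sub>0 'f"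
  have "?v \<in> supported (NR_ending d b)"
    using Cons by simp
  then have "lext (step d g) ?v \<in> supported (NR_ending d b)"
  proof (rule supported_lext)
    fix m assume "letters m \<in> NR_ending d b"
    then show "(step d g m :: monomial \<Rightarrow>\<^sub>0 'f) \<in> supported (NR_ending d b)"
      using step_supported[of "letters m" d b g] Cons.prems by simp
  qed
  then show ?case by simp
qed (simp add: unit_vector_supported)

text \<open>A sum relator makes \<open>unit_vector\<close> congruent to 1. For a longer word, the
  error is \<open>var g\<close> times the previous error plus the error of one
  \<open>step\<close>.\<close>

lemma act_unit_vector_cong:
  "(\<And>g. g \<in> set gs \<Longrightarrow> index g \<le> d) \<Longrightarrow>
    wrd gs - act d gs (unit_vector d b :: monomial \<Rightarrow>\<^sub>0 'f::field) \<in> relation_ideal d"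
proof (induction gs)
  case Nil
  have "1 - (\<Sum>i\<le>d. var (gen b i)) \<in> (relators d :: (monomial \<Rightarrow>\<^sub>0 'f) set)"
    unfolding relators_gen by blast
  then show ?case
    using relators_relation_ideal by (auto simp: wrd_Nil unit_vector_def var_wrd)
next
  case (Cons g gs)
  let ?v = "act d gs (unit_vector d b) :: monomial \<Rightarrow>\<^sub>0 'f"
  have "var g * (wrd gs - ?v) \<in> relation_ideal d"
    using Cons by (intro relation_ideal_lmult free_carrier_var) auto
  moreover have "var g * ?v - lext (step d g) ?v \<in> relation_ideal d"
    using Cons.prems by (intro lext_step_cong[where b = b] act_unit_vector_supported) auto
  ultimately have "var g * (wrd gs - ?v) + (var g * ?v - lext (step d g) ?v) \<in> relation_ideal d"
    by (rule relation_ideal_add)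
  then show ?case
    by (simp add: wrd_Cons algebra_simps)
qed

text \<open>No rewriting occurs: the last letter selects itself from the sum by orthogonality, and
  each earlier letter is simply prepended.\<close>

lemma act_unit_vector:
  "gs \<in> NR_ending d b \<Longrightarrow> act d gs (unit_vector d b) = (wrd gs :: monomial \<Rightarrow>\<^sub>0 'f::field)"
proof (induction gs)
  case Nil
  then show ?case using NR_ending_hd by blast
next
  case (Cons g gs)
  show ?case
  proof (cases "gs = []")
    case True
    with Cons.prems have g: "index g \<le> d" "starred g = b"
      by (auto simp: NR_ending_singleton)
    then have gen: "gen b (index g) = g"
      using gen_starred_index[of g] by (simp only:)
    have "act d [g] (unit_vector d b) =
        (\<Sum>i\<le>d. if i = index g then wrd [gen b i] else 0 :: monomial \<Rightarrow>\<^sub>0 'f)"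
      unfolding unit_vector_def act_simps lext_sum
      by (intro sum.cong) (use g in \<open>auto simp: lext_wrd step_def idem_eq_iff\<close>)
    then show ?thesis using True g by (simp add: gen)
  next
    case False
    with Cons show ?thesis
      using NR_ending_hd[of gs d b] by (simp add: NR_ending_Cons lext_wrd step_def)
  qed
qed

text \<open>The map sending \<open>p\<close> to \<open>rep d p (unit_vector d b)\<close> moves
  \<open>p\<close> only by an element of the ideal, lands in the span of the NR words, fixes that
  span and kills the ideal.\<close>

lemma complements_NR_ending:
  "complements d (supported (NR_ending d b) :: (monomial \<Rightarrow>\<^sub>0 'f::field) set)"
  unfolding complements_def
proof (intro conjI ballI subsetI)
  fix p :: "monomial \<Rightarrow>\<^sub>0 'f" assume p: "p \<in> carrier (free_algebra d)"
  let ?q = "rep d p (unit_vector d b)"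
  have "p = lext (\<lambda>m. wrd (letters m)) p"
    by (rule lext_idI[symmetric]) (simp add: wrd_def)
  then have "p - ?q = (\<Sum>m\<in>Poly_Mapping.keys p. const (Poly_Mapping.lookup p m) *
      (wrd (letters m) - act d (letters m) (unit_vector d b)))"
    by (simp add: rep_def lext_def right_diff_distrib sum_subtractf)
  also have "\<dots> \<in> relation_ideal d"
    using p by (intro relation_ideal_sum relation_ideal_lmult free_carrier_const act_unit_vector_cong)
      (auto simp: free_carrier_iff)
  finally have "p - ?q \<in> relation_ideal d" .
  moreover have "?q \<in> supported (NR_ending d b)"
    unfolding rep_def using p unfolding free_carrier_supported
    by (rule supported_lext) (auto intro: act_unit_vector_supported)
  ultimately show "\<exists>q\<in>supported (NR_ending d b). p - q \<in> relation_ideal d" by blast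
next
  fix q :: "monomial \<Rightarrow>\<^sub>0 'f" assume q: "q \<in> supported (NR_ending d b) \<inter> relation_ideal d"
  have "rep d q (unit_vector d b) = q"
    unfolding rep_def using q
    by (intro lext_idI) (auto simp: supported_def act_unit_vector wrd_def)
  then show "q \<in> {0}"
    using q rep_relation_ideal by fastforce
qed

section \<open>The bases given by the kind of the last or the first letter\<close>

lemma NR_words_ending: "NR_words d (\<lambda>gs. starred (last gs) = b) = word_product d ` NR_ending d b"
  by (auto simp: NR_words_def NR_ending_def)

text \<open>Inequality is symmetric; alternation of kinds and nonrepetition of indices both have
  this form.\<close>

lemma successively_neq_rev:
  "successively (\<lambda>x y. f x \<noteq> f y) (rev xs) \<longleftrightarrow> successively (\<lambda>x y. f x \<noteq> f y) xs"
  by (subst successively_rev, rule arg_cong[where f = "\<lambda>P. successively P xs"]) (auto intro!: ext)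

lemma rev_NR_ending:
  "rev ` NR_ending d b = {gs. is_word d gs \<and> nonrepeating gs \<and> starred (hd gs) = b}"
proof -
  have "is_word d (rev gs) \<longleftrightarrow> is_word d gs" "nonrepeating (rev gs) \<longleftrightarrow> nonrepeating gs" for gs
    by (simp_all only: is_word_def nonrepeating_def successively_neq_rev set_rev rev_is_Nil_conv)
  then have "gs \<in> rev ` NR_ending d b \<longleftrightarrow> is_word d gs \<and> nonrepeating gs \<and> starred (last (rev gs)) = b"
    for gs
    by (auto simp: NR_ending_def image_iff intro: exI[of _ "rev gs"])
  then show ?thesis
    by (auto simp: is_word_def last_rev)
qed

lemma NR_words_beginning:
  "NR_words d (\<lambda>gs. starred (hd gs) = b) = word_product d ` rev ` NR_ending d b"
  by (auto simp: NR_words_def rev_NR_ending)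

lemma basis_NR_words:
  "vectorspace.basis class_ring (A_alg d :: ('f::field, _) module)
    (NR_words d (\<lambda>gs. starred (last gs) = b))"
  "vectorspace.basis class_ring (A_alg d :: ('f::field, _) module)
    (NR_words d (\<lambda>gs. starred (hd gs) = b))"
  unfolding NR_words_ending NR_words_beginning
  by (intro basis_word_product complements_rev complements_NR_ending; auto dest: NR_ending_index)+

theorem theorem2p5:
  fixes d :: nat
  assumes "d \<ge> 1"
  shows "vectorspace.basis class_ring (A_alg d :: ('f::field, _) module)
           (NR_words d (\<lambda>gs. \<not> starred (last gs))) \<and>
         vectorspace.basis class_ring (A_alg d :: ('f::field, _) module)
           (NR_words d (\<lambda>gs. starred (last gs))) \<and>
         vectorspace.basis class_ring (A_alg d :: ('f::field, _) module)
           (NR_words d (\<lambda>gs. \<not> starred (hd gs))) \<and>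
         vectorspace.basis class_ring (A_alg d :: ('f::field, _) module)
           (NR_words d (\<lambda>gs. starred (hd gs)))"
  using basis_NR_words[of d False, where 'f = 'f] basis_NR_words[of d True, where 'f = 'f] by simp

end
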